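(* Let $p\in[0,1]$, $W\in\mathbb{N}$, $h\ge 0$ and $\pi>0$. For $y\in\mathbb{N}$ let $\omega^y\sim\mathrm{Binomial}(y,p)$ and define $$g(y)=\sum_{k=(y-W)^+}^{y}(k-y+W)\binom{y}{k}p^k(1-p)^{y-k}=\mathbb{E}\big[(\omega^y-y+W)^+\big],$$ $$L(y)=h\,y(1-p)+\pi\,\mathbb{E}\big[(\omega^y+W-y)^+\big].$$ Then $g$ and $L$ are discrete convex functions of $y$.
   Context: $\mathbb{N}=\{0,1,2,\dots\}$ and $(z)^+=\max(z,0)$. Note that the number of trials of $\omega^y$ is $y$ itself. A function $f:\mathbb{N}\to\mathbb{R}$ is discrete convex if $f(x-1)+f(x+1)\ge 2f(x)$ for all integers $x\ge 1$. *)

theory Defs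
  imports "HOL-Probability.Probability_Mass_Function"
begin

definition discrete_convex :: "(nat \<Rightarrow> real) \<Rightarrow> bool" where
  "discrete_convex f \<longleftrightarrow> (\<forall>x\<ge>1. f (x - 1) + f (x + 1) \<ge> 2 * f x)"

text \<open>The lower summation bound uses truncated subtraction on the natural numbers, which is
  the positive part of the integer difference of y and W.\<close>

definition g :: "real \<Rightarrow> nat \<Rightarrow> nat \<Rightarrow> real" where
  "g p W y = (\<Sum>k = y - W..y. (real k - real y + real W) * real (y choose k) * p ^ k * (1 - p) ^ (y - k))"

definition L :: "real \<Rightarrow> nat \<Rightarrow> real \<Rightarrow> real \<Rightarrow> nat \<Rightarrow> real" where
  "L p W h penalty y = h * real y * (1 - p) +
     penalty * measure_pmf.expectation (binomial_pmf y p) (\<lambda>w. max (real w + real W - real y) 0)"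

end

theory Submission
  imports Defs
begin

text \<open>
  The random variable \<open>y - \<omega>\<^sup>y\<close> counts the failures among \<open>y\<close> independent trials, and both \<open>g\<close> and
  the expectation in \<open>L\<close> equal \<open>E[f (y - \<omega>\<^sup>y)]\<close> for the convex function \<open>f x = max (W - x) 0\<close>.
  Adding one more trial raises the number of failures by one with probability \<open>q = 1 - p\<close>,
  independently of the earlier trials. Conditioning on this trial shows that the forward
  difference of \<open>y \<mapsto> E[f (y - \<omega>\<^sup>y)]\<close> is \<open>q\<close> times the same expectation with the forward
  difference of \<open>f\<close> in place of \<open>f\<close>. Doing this twice, the second difference is
  \<open>q\<^sup>2 E[f N - 2 f (N + 1) + f (N + 2)]\<close> for \<open>N = y - \<omega>\<^sup>y\<close>, whose integrand is nonnegative
  pointwise because \<open>f\<close> is convex.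

  The function \<open>L\<close> is then an affine function of \<open>y\<close> plus a nonnegative multiple of \<open>g\<close>. That the
  finite sum defining \<open>g\<close> is the expectation holds because \<open>k - y + W\<close> is
  negative exactly for the indices \<open>k < y - W\<close>, where its positive part vanishes.
\<close>

text \<open>
  The failure count \<open>n - w\<close> is kept as a real number: truncated subtraction would make the shift
  \<open>Suc n - w = Suc (n - w)\<close> true only for \<open>w \<le> n\<close>.
\<close>

definition failures_expectation :: "real \<Rightarrow> nat \<Rightarrow> (real \<Rightarrow> real) \<Rightarrow> real" where
  "failures_expectation p n f =
     measure_pmf.expectation (binomial_pmf n p) (\<lambda>w. f (real n - real w))"

text \<open>
  Condition on one of the \<open>n + 1\<close> trials: a success leaves the number of failures unchanged, a
  failure raises it by one.
\<close>

lemma failures_expectation_Suc: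
  assumes "p \<in> {0..1}"
  shows "failures_expectation p (Suc n) f =
           p * failures_expectation p n f + (1 - p) * failures_expectation p n (\<lambda>x. f (x + 1))"
proof -
  have trial: "measure_pmf.expectation
      (binomial_pmf n p \<bind> (\<lambda>k. return_pmf ((if b then 1 else 0) + k))) (\<lambda>w. f (real (Suc n) - real w))
    = (if b then failures_expectation p n f else failures_expectation p n (\<lambda>x. f (x + 1)))" for b
    by (simp add: failures_expectation_def map_pmf_def[symmetric] algebra_simps)
  have "failures_expectation p (Suc n) f = (\<Sum>b\<in>UNIV. pmf (bernoulli_pmf p) b *\<^sub>R
      measure_pmf.expectation (binomial_pmf n p \<bind> (\<lambda>k. return_pmf ((if b then 1 else 0) + k)))
        (\<lambda>w. f (real (Suc n) - real w)))"
    unfolding failures_expectation_def[of p "Suc n"] binomial_pmf_Suc[OF assms]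
    using finite_set_pmf_binomial_pmf[OF assms]
    by (intro pmf_expectation_bind) (auto simp: map_pmf_def[symmetric])
  then show ?thesis
    unfolding trial using assms by (simp add: UNIV_bool)
qed

lemma discrete_convex_failures_expectation:
  assumes p: "p \<in> {0..1}"
    and f: "\<And>x. 2 * f (x + 1) \<le> f x + f (x + 2)"
  shows "discrete_convex (\<lambda>n. failures_expectation p n f)"
proof -
  have second_difference: "2 * failures_expectation p (Suc n) f
          \<le> failures_expectation p n f + failures_expectation p (Suc (Suc n)) f" for n
  proof -
    have "0 \<le> failures_expectation p n (\<lambda>x. f x - 2 * f (x + 1) + f (x + 2))"
      unfolding failures_expectation_def
    proof (rule Bochner_Integration.integral_nonneg)
      show "0 \<le> f (real n - real w) - 2 * f (real n - real w + 1) + f (real n - real w + 2)" for w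
        using f[of "real n - real w"] by linarith
    qed
    also have "\<dots> = failures_expectation p n f - 2 * failures_expectation p n (\<lambda>x. f (x + 1))
                    + failures_expectation p n (\<lambda>x. f (x + 2))"
      using p by (simp add: failures_expectation_def)
    finally have "0 \<le> (1 - p)^2 * (failures_expectation p n f
        - 2 * failures_expectation p n (\<lambda>x. f (x + 1)) + failures_expectation p n (\<lambda>x. f (x + 2)))"
      by simp
    also have "\<dots> = failures_expectation p n f - 2 * failures_expectation p (Suc n) f
                    + failures_expectation p (Suc (Suc n)) f"
      by (simp add: failures_expectation_Suc[OF p] add.assoc) (simp add: algebra_simps power2_eq_square)
    finally show ?thesis by simp
  qed
  show ?thesis
    unfolding discrete_convex_def
  proof (intro allI impI)
    fix x :: nat
    assume "1 \<le> x"
    then obtain n where "x = Suc n" by (cases x) auto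
    then show "2 * failures_expectation p x f
        \<le> failures_expectation p (x - 1) f + failures_expectation p (x + 1) f"
      using second_difference[of n] by simp
  qed
qed

lemma discrete_convex_affine_plus_nonneg_mult:
  assumes "discrete_convex f" and "0 \<le> c"
  shows "discrete_convex (\<lambda>n. a * real n + b + c * f n)"
  unfolding discrete_convex_def
proof (intro allI impI)
  fix x :: nat
  assume x: "1 \<le> x"
  have "c * (2 * f x) \<le> c * (f (x - 1) + f (x + 1))"
    using assms x by (intro mult_left_mono) (auto simp: discrete_convex_def)
  with x show "2 * (a * real x + b + c * f x)
      \<le> a * real (x - 1) + b + c * f (x - 1) + (a * real (x + 1) + b + c * f (x + 1))"
    by (simp add: of_nat_diff algebra_simps)
qed

text \<open>
  The summands of \<open>g\<close> carry no positive part: the lower bound \<open>y - W\<close> removes precisely the indices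
  at which \<open>k - y + W\<close> is negative, also when \<open>y < W\<close> and nothing is removed.
\<close>

lemma g_eq_expectation:
  assumes p: "p \<in> {0..1}"
  shows "g p W y =
    measure_pmf.expectation (binomial_pmf y p) (\<lambda>w. max (real w - real y + real W) 0)"
proof -
  have "g p W y = (\<Sum>k\<le>y. real (y choose k) * p ^ k * (1 - p) ^ (y - k)
                            * max (real k - real y + real W) 0)"
    unfolding g_def
  proof (rule sum.mono_neutral_cong_left)
    show "\<forall>k\<in>{..y} - {y - W..y}. real (y choose k) * p ^ k * (1 - p) ^ (y - k)
            * max (real k - real y + real W) 0 = 0"
      by auto
    show "(real k - real y + real W) * real (y choose k) * p ^ k * (1 - p) ^ (y - k)
        = real (y choose k) * p ^ k * (1 - p) ^ (y - k) * max (real k - real y + real W) 0"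
      if "k \<in> {y - W..y}" for k
    proof -
      have "0 \<le> real k - real y + real W" using that by auto
      then show ?thesis by (simp add: max_def)
    qed
  qed auto
  then show ?thesis
    by (simp add: expectation_binomial_pmf'[OF p])
qed

theorem lemma2:
  fixes p h penalty :: real and W :: nat
  assumes "0 \<le> p" and "p \<le> 1" and "h \<ge> 0" and "penalty > 0"
  shows "(\<forall>y. g p W y =
            measure_pmf.expectation (binomial_pmf y p) (\<lambda>w. max (real w - real y + real W) 0))
       \<and> discrete_convex (g p W) \<and> discrete_convex (L p W h penalty)"
proof -
  have p: "p \<in> {0..1}" using assms by simp
  have "g p W y = failures_expectation p y (\<lambda>x. max (real W - x) 0)" for y
    unfolding g_eq_expectation[OF p] failures_expectation_def by (simp add: algebra_simps)
  then have "g p W = (\<lambda>y. failures_expectation p y (\<lambda>x. max (real W - x) 0))"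
    by (rule ext)
  then have g: "discrete_convex (g p W)"
    using discrete_convex_failures_expectation[OF p, of "\<lambda>x. max (real W - x) 0"]
    by (auto simp: max_def)
  have "L p W h penalty = (\<lambda>y. h * (1 - p) * real y + 0 + penalty * g p W y)"
    unfolding L_def g_eq_expectation[OF p] by (intro ext) (simp add: algebra_simps)
  then have "discrete_convex (L p W h penalty)"
    using discrete_convex_affine_plus_nonneg_mult[OF g, of penalty "h * (1 - p)" 0] assms by simp
  then show ?thesis
    using g g_eq_expectation[OF p] by simp
qed

end
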